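(* Let $r_n$ be the starting position of the first occurrence of the word $1^n$ in $\mathbf{b}$. Then $r_1 = 1$, $r_2 = 5$, and $r_{n+1} = 2^{r_n - 2} + r_n$ for all $n \geq 2$.
   Context: Define finite binary words $B_i$ by $B_1 = 101$ and $B_{i+1} = B_i C_i$ for $i \geq 1$, where $C_i$ is the word obtained from $B_i$ by removing its first $i$ symbols. Since each $B_i$ is a prefix of $B_{i+1}$, there is a unique infinite binary word $\mathbf{b}$ of which every $B_i$ is a prefix. Words are indexed starting at position $1$; $1^n$ denotes the word consisting of $n$ ones. *)

theory Defs
  imports "HOL-Library.Stream" "HOL-Library.Z2"
begin

text \<open>
  Letters are elements of \<^typ>\<open>bit\<close>, finite binary words are lists and infinite binary words are
  streams. In the last equation \<^term>\<open>drop (Suc i) (B_word (Suc i))\<close> is the word $C_{i+1}$.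
  The index starts at 1; the value at 0 is a dummy.
\<close>

fun B_word :: "nat \<Rightarrow> bit list" where
  "B_word 0 = []"
| "B_word (Suc 0) = [1, 0, 1]"
| "B_word (Suc (Suc i)) = B_word (Suc i) @ drop (Suc i) (B_word (Suc i))"

definition stream_prefix :: "'a list \<Rightarrow> 'a stream \<Rightarrow> bool" where
  "stream_prefix u x \<longleftrightarrow> stake (length u) x = u"

definition b_word :: "bit stream" where
  "b_word = (THE x. \<forall>i\<ge>1. stream_prefix (B_word i) x)"

text \<open>Positions are counted from 1, whereas \<^const>\<open>sdrop\<close> counts from 0.\<close>

definition occurs_at :: "'a list \<Rightarrow> 'a stream \<Rightarrow> nat \<Rightarrow> bool" where
  "occurs_at u x p \<longleftrightarrow> p \<ge> 1 \<and> stream_prefix u (sdrop (p - 1) x)"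

text \<open>Unspecified if \<open>u\<close> does not occur in \<open>x\<close>.\<close>

definition first_occurrence :: "'a list \<Rightarrow> 'a stream \<Rightarrow> nat" where
  "first_occurrence u x = (LEAST p. occurs_at u x p)"

definition r :: "nat \<Rightarrow> nat" where
  "r n = first_occurrence (replicate n 1) b_word"

lemma length_B_word: "Suc i < length (B_word (Suc i))"
proof (induction i)
  case (Suc i)
  then show ?case by simp
qed simp

lemma B_word_nth:
  assumes "i \<le> j" "k < length (B_word (Suc i))"
  shows "k < length (B_word (Suc j)) \<and> B_word (Suc j) ! k = B_word (Suc i) ! k"
  using assms(1)
proof (induction j rule: dec_induct)
  case base
  then show ?case using assms(2) by simp
next
  case (step j)
  then show ?case by (auto simp: nth_append)
qed

lemma stream_prefix_iff: "stream_prefix u x \<longleftrightarrow> (\<forall>k<length u. x !! k = u ! k)"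
  unfolding stream_prefix_def by (auto simp: list_eq_iff_nth_eq)

lemma ex1_b_word: "\<exists>!x. \<forall>i\<ge>1. stream_prefix (B_word i) x"
proof (rule ex1I)
  let ?x = "smap (\<lambda>k. B_word (Suc k) ! k) nats"
  show "\<forall>i\<ge>1. stream_prefix (B_word i) ?x"
  proof (intro allI impI)
    fix i :: nat
    assume "i \<ge> 1"
    then obtain j where j: "i = Suc j" by (cases i) auto
    have "B_word (Suc k) ! k = B_word (Suc j) ! k" if "k < length (B_word (Suc j))" for k
      using B_word_nth[of j k k] B_word_nth[of k j k] that length_B_word[of k]
      by (cases "j \<le> k") auto
    then show "stream_prefix (B_word i) ?x"
      by (simp add: stream_prefix_iff j)
  qed
  fix y
  assume y: "\<forall>i\<ge>1. stream_prefix (B_word i) y"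
  have "B_word (Suc k) ! k = y !! k" for k
    using y[rule_format, of "Suc k"] length_B_word[of k] by (simp add: stream_prefix_iff)
  then show "y = ?x"
    by (subst eq_commute) (simp add: smap_alt)
qed

lemma b_word_prefix: "i \<ge> 1 \<Longrightarrow> stream_prefix (B_word i) b_word"
  using theI'[OF ex1_b_word] unfolding b_word_def by blast

end

(* Counting from 0, let b(k) be the letters of b. As B_{i+1} has length L = 2^i + i + 2, the
   definition says b(L + k) = b(i + 1 + k) for k <= 2^i, and every B_{i+1} ends in 01. Hence a
   block 1^(n+1) appears in B_{i+2} but not in B_{i+1} only if it starts at the last letter of
   B_{i+1}, the copied part then beginning with 1^n, that is, 1^n occurring at position i + 2.
   The first such i is r_n - 2, and the last letter of B_{i+1} is at position 2^(r_n - 2) + r_n. *)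
theory Submission
  imports Defs
begin

lemma length_B_word_eq: "length (B_word (Suc i)) = 2 ^ i + i + 2"
  by (induction i) auto

lemma b_word_nth: "k < 2 ^ i + i + 2 \<Longrightarrow> b_word !! k = B_word (Suc i) ! k"
  using b_word_prefix[of "Suc i"] by (simp add: stream_prefix_iff length_B_word_eq)

lemma b_word_copy:
  assumes "k \<le> 2 ^ i"
  shows "b_word !! (2 ^ i + i + 2 + k) = b_word !! (i + 1 + k)"
proof -
  have "b_word !! (2 ^ i + i + 2 + k) = B_word (Suc (Suc i)) ! (2 ^ i + i + 2 + k)"
    using assms by (intro b_word_nth) simp
  also have "\<dots> = B_word (Suc i) ! (i + 1 + k)"
    using assms by (simp add: nth_append length_B_word_eq)
  also have "\<dots> = b_word !! (i + 1 + k)"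
    using assms by (intro b_word_nth[symmetric]) simp
  finally show ?thesis .
qed

lemma b_word_initial: "b_word !! 0 = 1" "b_word !! 1 = 0" "b_word !! 2 = 1"
  using b_word_nth[of 0 0] b_word_nth[of 1 0] b_word_nth[of 2 0] by (simp_all del: snth.simps)

text \<open>Dropping a proper prefix of a word keeps its last letter, so every block inherits its
  last letter from \<open>B_word 1\<close>; offset \<open>2 ^ i\<close> is the last one that is
  copied.\<close>

lemma b_word_block_last: "b_word !! (2 ^ i + i + 1) = 1"
proof (induction i)
  case 0
  show ?case using b_word_initial(3) by (simp add: numeral_2_eq_2)
next
  case (Suc i)
  then show ?case using b_word_copy[of "2 ^ i" i] by (simp add: algebra_simps mult_2)
qed

lemma b_word_block_penultimate: "b_word !! (2 ^ i + i) = 0"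
proof (induction i)
  case 0
  show ?case using b_word_initial(2) by simp
next
  case (Suc i)
  \<comment> \<open>The penultimate copied letter has offset \<open>2 ^ i - 1\<close>; positivity of
    the power makes this subtraction exact.\<close>
  have "(2::nat) ^ i \<ge> 1" by simp
  then have "2 ^ i + i + 2 + (2 ^ i - 1) = 2 ^ Suc i + Suc i" "i + 1 + (2 ^ i - 1) = 2 ^ i + i"
    by simp_all
  then show ?case using Suc b_word_copy[of "2 ^ i - 1" i] by (metis diff_le_self)
qed

lemma occurs_at_ones_iff:
  "occurs_at (replicate n 1) x p \<longleftrightarrow> p \<ge> 1 \<and> (\<forall>j<n. x !! (p - 1 + j) = 1)"
  by (auto simp: occurs_at_def stream_prefix_iff sdrop_snth)

text \<open>With indices from 0, the bound on \<open>q\<close> says that the window of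
  \<open>n + 1\<close> letters starts before the last letter of \<open>B_word (Suc i)\<close>. In
  the induction a window inside the copied part is shifted back into the previous block.\<close>

lemma ones_not_within_block:
  assumes "n \<ge> 1"
    and no: "\<And>q. q \<le> i \<Longrightarrow> \<exists>j<n. b_word !! (q + j) = 0"
    and "q \<le> 2 ^ i + i"
  shows "\<exists>j\<le>n. b_word !! (q + j) = 0"
  using no assms(3)
proof (induction i arbitrary: q)
  case 0
  then have "q = 0 \<or> q = 1" by auto
  then show ?case using b_word_initial(2) \<open>n \<ge> 1\<close> by force
next
  case (Suc i)
  define L :: nat where "L = 2 ^ i + i + 2"
  have ih: "\<exists>j\<le>n. b_word !! (q' + j) = 0" if "q' \<le> 2 ^ i + i" for q'
    using Suc.IH[of q'] Suc.prems(1) that by simp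
  \<comment> \<open>Index \<open>2 ^ Suc i + Suc i\<close> carries the penultimate letter 0 of the
    new block. A window that reaches it is settled; any other lies inside the block, so copying
    applies to all its letters from index \<open>L\<close> on.\<close>
  consider (old) "q \<le> 2 ^ i + i" | (last) "q + n \<ge> 2 ^ Suc i + Suc i"
    | (boundary) "q + 1 = L" "q + n < 2 ^ Suc i + Suc i"
    | (new) k where "q = L + k" "q + n < 2 ^ Suc i + Suc i"
  proof -
    have "q \<le> 2 ^ i + i \<or> q + 1 = L \<or> L \<le> q"
      unfolding L_def by linarith
    then show ?thesis using that by (meson le_Suc_ex not_le)
  qed
  then show ?case
  proof cases
    case old
    then show ?thesis by (rule ih)
  next
    case last
    then show ?thesis
      using Suc.prems(2) b_word_block_penultimate[of "Suc i"]
      by (intro exI[of _ "2 ^ Suc i + Suc i - q"]) simp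
  next
    case boundary
    \<comment> \<open>After its first letter the window replicates the \<open>n\<close> letters from
      index \<open>Suc i\<close>, exactly the start that the hypothesis gains in this induction
      step.\<close>
    obtain j where j: "j < n" "b_word !! (Suc i + j) = 0"
      using Suc.prems(1)[of "Suc i"] by blast
    have "j \<le> 2 ^ i" using boundary j(1) by (simp add: L_def)
    then have "b_word !! (L + j) = 0"
      using b_word_copy[of j i] j(2) by (simp add: L_def)
    then show ?thesis using boundary(1) j(1) by (intro exI[of _ "Suc j"]) auto
  next
    case new
    have "i + 1 + k \<le> 2 ^ i + i" using new by (simp add: L_def)
    then obtain j where j: "j \<le> n" "b_word !! (i + 1 + k + j) = 0"
      using ih by blast
    have "k + j \<le> 2 ^ i" using new j(1) by (simp add: L_def)
    then have "b_word !! (L + (k + j)) = 0"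
      using b_word_copy[of "k + j" i] j(2) by (simp add: L_def add.assoc)
    then show ?thesis using new(1) j(1) by (auto simp: add.assoc)
  qed
qed

lemma ones_extend:
  assumes ones: "\<And>j. j < n \<Longrightarrow> b_word !! (i + 1 + j) = 1" and "j \<le> n"
  shows "b_word !! (2 ^ i + i + 1 + j) = 1"
proof (cases j)
  case 0
  then show ?thesis using b_word_block_last[of i] by simp
next
  case (Suc k)
  \<comment> \<open>The run of ones from index \<open>i + 1\<close> must stop before the penultimate
    0 of the block, so \<open>n < 2 ^ i\<close> and the whole run is copied.\<close>
  have pos: "(2::nat) ^ i \<ge> 1" by simp
  then have "i + 1 + (2 ^ i - 1) = 2 ^ i + i" by simp
  then have "\<not> 2 ^ i - 1 < n"
    using ones[of "2 ^ i - 1"] b_word_block_penultimate[of i] by (metis zero_neq_one)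
  then have "k \<le> 2 ^ i" using Suc \<open>j \<le> n\<close> pos by simp
  then show ?thesis using b_word_copy[of k i] ones[of k] Suc \<open>j \<le> n\<close> by simp
qed

lemma r_eqI:
  assumes "occurs_at (replicate n 1) b_word p"
    and "\<And>q. occurs_at (replicate n 1) b_word q \<Longrightarrow> p \<le> q"
  shows "r n = p"
  unfolding r_def first_occurrence_def using assms by (rule Least_equality)

lemma r_minimal: "occurs_at (replicate n 1) b_word q \<Longrightarrow> r n \<le> q"
  unfolding r_def first_occurrence_def by (rule Least_le)

lemma r_step:
  assumes "n \<ge> 1" "occurs_at (replicate n 1) b_word (r n)" "r n \<ge> 2"
  shows "occurs_at (replicate (n + 1) 1) b_word (2 ^ (r n - 2) + r n)"
    and "r (n + 1) = 2 ^ (r n - 2) + r n"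
proof -
  \<comment> \<open>Counted from 0, position \<open>r n\<close> is index \<open>i + 1\<close>, where
    the copied part of \<open>B_word (Suc i)\<close> begins.\<close>
  obtain i where i: "r n = i + 2" using assms(3) le_Suc_ex by (metis add.commute)
  have ones: "b_word !! (i + 1 + j) = 1" if "j < n" for j
    using assms(2) that by (simp add: occurs_at_ones_iff i)
  have "b_word !! (2 ^ i + i + 1 + j) = 1" if "j \<le> n" for j
    by (rule ones_extend[OF ones that])
  then show occ: "occurs_at (replicate (n + 1) 1) b_word (2 ^ (r n - 2) + r n)"
    unfolding occurs_at_ones_iff by (auto simp: i)
  have no: "\<exists>j<n. b_word !! (q + j) = 0" if "q \<le> i" for q
  proof -
    have "\<not> occurs_at (replicate n 1) b_word (q + 1)"
      using r_minimal[of n "q + 1"] that by (auto simp: i)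
    then show ?thesis by (auto simp: occurs_at_ones_iff)
  qed
  show "r (n + 1) = 2 ^ (r n - 2) + r n"
  proof (rule r_eqI[OF occ], rule ccontr)
    fix q
    assume q: "occurs_at (replicate (n + 1) 1) b_word q"
      and "\<not> 2 ^ (r n - 2) + r n \<le> q"
    then have "q - 1 \<le> 2 ^ i + i" by (simp add: i)
    then obtain j where "j \<le> n" "b_word !! (q - 1 + j) = 0"
      using ones_not_within_block[OF assms(1) no] by blast
    then show False using q unfolding occurs_at_ones_iff by (auto simp: less_Suc_eq_le)
  qed
qed

lemma r_1: "occurs_at (replicate 1 1) b_word 1" "r 1 = 1"
proof -
  show occ: "occurs_at (replicate 1 1) b_word 1"
    using b_word_initial(1) unfolding occurs_at_ones_iff by simp
  show "r 1 = 1" by (rule r_eqI[OF occ]) (simp add: occurs_at_def)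
qed

lemma r_2: "occurs_at (replicate 2 1) b_word 5" "r 2 = 5"
proof -
  \<comment> \<open>These are the letters of \<open>B_word 3\<close>.\<close>
  have b: "b_word !! k = [1,0,1,0,1,1,0,1] ! k" if "k < 8" for k
    using b_word_nth[of k 2] that by (simp add: numeral_2_eq_2)
  show occ: "occurs_at (replicate 2 1) b_word 5"
    by (auto simp: occurs_at_ones_iff less_2_cases_iff b)
  show "r 2 = 5"
  proof (rule r_eqI[OF occ], rule ccontr)
    fix q
    assume q: "occurs_at (replicate 2 1) b_word q" and "\<not> 5 \<le> q"
    then have "b_word !! (q - 1) = 1" "b_word !! q = 1" "q \<in> {1,2,3,4}"
      using spec[of "\<lambda>j. j < 2 \<longrightarrow> b_word !! (q - 1 + j) = 1" 0]
        spec[of "\<lambda>j. j < 2 \<longrightarrow> b_word !! (q - 1 + j) = 1" 1]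
      by (auto simp: occurs_at_ones_iff)
    then show False by (auto simp: b simp del: snth.simps)
  qed
qed

text \<open>\<open>LEAST\<close> says nothing without a witness, so existence is carried along the
  recursion. The bound keeps \<open>r n - 2\<close> from being truncated; as \<open>r 1 = 1\<close>,
  the induction starts at 2.\<close>

lemma r_occurs:
  assumes "n \<ge> 2"
  shows "occurs_at (replicate n 1) b_word (r n) \<and> r n \<ge> 2"
  using assms
proof (induction n rule: dec_induct)
  case base
  then show ?case using r_2 by simp
next
  case (step n)
  then show ?case using r_step[of n] by simp
qed

theorem theorem4:
  shows "(\<forall>n\<ge>1. \<exists>p. occurs_at (replicate n 1) b_word p)
    \<and> r 1 = 1 \<and> r 2 = 5 \<and> (\<forall>n\<ge>2. r (n + 1) = 2 ^ (r n - 2) + r n)"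
proof (intro conjI allI impI)
  fix n :: nat
  assume "n \<ge> 1"
  then consider "n = 1" | "n \<ge> 2" by linarith
  then show "\<exists>p. occurs_at (replicate n 1) b_word p"
    using r_1(1) r_occurs[of n] by cases blast+
next
  fix n :: nat
  assume "n \<ge> 2"
  then show "r (n + 1) = 2 ^ (r n - 2) + r n"
    using r_step(2)[of n] r_occurs[of n] by simp
qed (fact r_1(2) r_2(2))+

end
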